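(* Let $G=(V,E)$ be a finite connected graph with signed incidence matrix $P$, and let $X=(x_1,\dots,x_k)$, $Y=(y_1,\dots,y_k)$ be (balanced) partitions in $\mathrm{Prob}(V)^{k*}$. The lifted distance $A(X,Y)=\min_{S\in\mathrm{DS}_k}\sum_{i,j}S_{ij}W_1(x_i,y_j)$ satisfies $$A(X,Y)=\min\Big\{\ \sum_{i,j=1}^k\sum_{e\in E}|Q_{ij}^e|\ :\ Q\in\mathbb{R}^{|E|\times k^2},\ S\in\mathrm{DS}_k,\ P^\top Q_{ij}-(x_i-y_j)S_{ij}=0\ \text{ for all } i,j\in\{1,\dots,k\}\Big\},$$ where $Q_{ij}=(Q_{ij}^e)_{e\in E}\in\mathbb{R}^{|E|}$.
   Context: Graphs are simple, and each edge is given a fixed orientation. The signed incidence matrix $P\in\mathbb{R}^{|E|\times|V|}$ has $P_{ev}=-1$ if $e=(v,w)$ for some $w$, $P_{ev}=1$ if $e=(w,v)$ for some $w$, and $P_{ev}=0$ otherwise. $\mathrm{Prob}(V)=\{x\in\mathbb{R}^{|V|} : x\ge 0,\ \sum_{v}x(v)=1\}$, and $\mathrm{Prob}(V)^{k*}$ is the set of $k$-tuples of elements of $\mathrm{Prob}(V)$ up to reordering; its elements represent balanced partitions of $G$ with $k$ components (for instance, a set partition $(V_1,\dots,V_k)$ of $V$ is represented by $x_i(v)=1/|V_i|$ for $v\in V_i$ and $0$ otherwise). For $x,y\in\mathrm{Prob}(V)$, the 1-Wasserstein distance is $W_1(x,y)=\min\{\sum_{e\in E}|J_e| : J\in\mathbb{R}^{|E|},\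 P^\top J=y-x\}$. $\mathrm{DS}_k$ is the set of doubly stochastic $k\times k$ matrices (nonnegative, all rows and columns summing to 1). *)

theory Defs
  imports
    Complex_Main
    "HOL-Library.Multiset"
    "HOL-Combinatorics.Permutations"
    "Graph_Theory.Graph_Theory"
begin

(* The library's pair_graph contains both arcs of every edge. Here parcs G contains exactly one
   arc per edge, so it serves both as the edge set E and as the fixed orientation. *)
locale oriented_simple_graph = pair_digraph +
  assumes one_orientation: "(u, v) \<in> parcs G \<Longrightarrow> (v, u) \<notin> parcs G"

definition incidence :: "'v pair_pre_digraph \<Rightarrow> 'v \<times> 'v \<Rightarrow> 'v \<Rightarrow> real" where
  "incidence G e v =
     (if e \<in> parcs G \<and> fst e = v then - 1 else if e \<in> parcs G \<and> snd e = v then 1 else 0)"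

(* The matrix-vector product of the transposed incidence matrix with J. *)
definition incidence_transpose ::
    "'v pair_pre_digraph \<Rightarrow> ('v \<times> 'v \<Rightarrow> real) \<Rightarrow> 'v \<Rightarrow> real" where
  "incidence_transpose G J v = (\<Sum>e\<in>parcs G. incidence G e v * J e)"

(* A vector indexed by V is a function vanishing outside V, so that equality of functions is
   equality of vectors. *)
definition Prob :: "'v set \<Rightarrow> ('v \<Rightarrow> real) set" where
  "Prob V = {x. (\<forall>v\<in>V. 0 \<le> x v) \<and> (\<forall>v. v \<notin> V \<longrightarrow> x v = 0) \<and> (\<Sum>v\<in>V. x v) = 1}"

(* k-tuples up to reordering *)
definition unordered_tuples :: "nat \<Rightarrow> 'a set \<Rightarrow> 'a multiset set" where
  "unordered_tuples k A = {X. size X = k \<and> set_mset X \<subseteq> A}"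

definition is_minimum :: "'a::linorder \<Rightarrow> 'a set \<Rightarrow> bool" where
  "is_minimum m A \<longleftrightarrow> m \<in> A \<and> (\<forall>a\<in>A. m \<le> a)"

(* Unlike Min, not restricted to finite sets; unlike Inf, unspecified if no minimum is attained. *)
definition minimum :: "'a::linorder set \<Rightarrow> 'a" where
  "minimum A = (THE m. is_minimum m A)"

definition W1 :: "'v pair_pre_digraph \<Rightarrow> ('v \<Rightarrow> real) \<Rightarrow> ('v \<Rightarrow> real) \<Rightarrow> real" where
  "W1 G x y = minimum {\<Sum>e\<in>parcs G. \<bar>J e\<bar> | J.
     \<forall>v\<in>pverts G. incidence_transpose G J v = y v - x v}"

(* Rows and columns are indexed by 0, ..., k - 1; the other entries are irrelevant. *)
definition DS :: "nat \<Rightarrow> (nat \<Rightarrow> nat \<Rightarrow> real) set" where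
  "DS k = {S. (\<forall>i<k. \<forall>j<k. 0 \<le> S i j) \<and> (\<forall>i<k. (\<Sum>j<k. S i j) = 1) \<and>
              (\<forall>j<k. (\<Sum>i<k. S i j) = 1)}"

definition lifted_cost ::
    "('a \<Rightarrow> 'a \<Rightarrow> real) \<Rightarrow> 'a list \<Rightarrow> 'a list \<Rightarrow> real" where
  "lifted_cost d xs ys = minimum {\<Sum>i<length xs. \<Sum>j<length xs. S i j * d (xs ! i) (ys ! j) | S.
     S \<in> DS (length xs)}"

(* The choice of representing tuples is immaterial: see lifted_dist_mset. *)
definition lifted_dist ::
    "('a \<Rightarrow> 'a \<Rightarrow> real) \<Rightarrow> 'a multiset \<Rightarrow> 'a multiset \<Rightarrow> real" where
  "lifted_dist d X Y = lifted_cost d (SOME xs. mset xs = X) (SOME ys. mset ys = Y)"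

lemma DS_permute:
  assumes "S \<in> DS k" "p permutes {..<k}" "q permutes {..<k}"
  shows "(\<lambda>i j. S (p i) (q j)) \<in> DS k"
proof -
  have r: "(\<Sum>j<k. f (q j)) = (\<Sum>j<k. f j)" "(\<Sum>j<k. f (p j)) = (\<Sum>j<k. f j)"
    for f :: "nat \<Rightarrow> real"
    using sum.permute[OF assms(3), of f] sum.permute[OF assms(2), of f] by (simp_all add: o_def)
  have "p i < k" "q i < k" if "i < k" for i
    using permutes_in_image[OF assms(2), of i] permutes_in_image[OF assms(3), of i] that by auto
  then show ?thesis
    using assms(1) r(1)[of "\<lambda>j. S (p i) j" for i] r(2)[of "\<lambda>i. S i (q j)" for j]
    unfolding DS_def by auto
qed

lemma lifted_cost_cong_mset:
  assumes "mset xs = mset xs'" "mset ys = mset ys'" "length xs = length ys"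
  shows "lifted_cost d xs ys = lifted_cost d xs' ys'"
proof -
  define costs where "costs us vs = {\<Sum>i<length us. \<Sum>j<length us. S i j * d (us ! i) (vs ! j) | S.
     S \<in> DS (length us)}" for us vs
  have sub: "costs us vs \<subseteq> costs us' vs'"
    if m: "mset us' = mset us" "mset vs' = mset vs" and l: "length us = length vs" for us us' vs vs'
  proof
    fix c assume "c \<in> costs us vs"
    then obtain S where S: "S \<in> DS (length us)"
      and c: "c = (\<Sum>i<length us. \<Sum>j<length us. S i j * d (us ! i) (vs ! j))"
      unfolding costs_def by blast
    obtain p where p: "p permutes {..<length us}" "permute_list p us = us'"
      using mset_eq_permutation[OF m(1)] .
    obtain q where q: "q permutes {..<length us}" "permute_list q vs = vs'"
      using mset_eq_permutation[OF m(2)] l by metis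
    have n: "us' ! i = us ! p i" "vs' ! i = vs ! q i" if "i < length us" for i
      using permute_list_nth[OF p(1) that] permute_list_nth[of q vs i] p(2) q l that by auto
    have len: "length us' = length us" using p(2) by auto
    have "c = (\<Sum>i<length us. \<Sum>j<length us. S (p i) j * d (us ! p i) (vs ! j))"
      unfolding c using sum.permute[OF p(1)] by (simp add: o_def)
    also have "\<dots> = (\<Sum>i<length us. \<Sum>j<length us. S (p i) (q j) * d (us ! p i) (vs ! q j))"
      using sum.permute[OF q(1)[unfolded l], of "\<lambda>j. S (p i) j * d (us ! p i) (vs ! j)" for i] l
      by (simp add: o_def)
    also have "\<dots> = (\<Sum>i<length us'. \<Sum>j<length us'. S (p i) (q j) * d (us' ! i) (vs' ! j))"
      by (intro sum.cong) (simp_all add: n len)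
    finally show "c \<in> costs us' vs'"
      unfolding costs_def using DS_permute[OF S p(1) q(1)] len by auto
  qed
  have "length xs' = length ys'" using assms by (metis size_mset)
  then have "costs xs ys = costs xs' ys'"
    using assms by (intro subset_antisym sub) auto
  then show ?thesis by (simp add: lifted_cost_def costs_def)
qed

lemma lifted_dist_mset:
  assumes "length xs = length ys"
  shows "lifted_dist d (mset xs) (mset ys) = lifted_cost d xs ys"
proof -
  have "mset (SOME us. mset us = mset zs) = mset zs" for zs :: "'a list"
    by (rule someI[of _ zs]) simp
  then show ?thesis
    unfolding lifted_dist_def by (metis assms lifted_cost_cong_mset)
qed

end

theory Submission
  imports Defs "HOL-Analysis.Function_Topology"
begin

text \<open>
  Both minima are attained, by compactness. Given a doubly stochastic \<open>S\<close>, the substitution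
  \<open>Q\<^sub>i\<^sub>j = - S\<^sub>i\<^sub>j J\<^sub>i\<^sub>j\<close> relates the flows \<open>J\<^sub>i\<^sub>j\<close> from \<open>x\<^sub>i\<close> to \<open>y\<^sub>j\<close> to the feasible \<open>Q\<^sub>i\<^sub>j\<close>, and it
  multiplies the cost by \<open>S\<^sub>i\<^sub>j\<close>; where \<open>S\<^sub>i\<^sub>j = 0\<close> it cannot be inverted, but there the term
  \<open>S\<^sub>i\<^sub>j W\<^sub>1(x\<^sub>i, y\<^sub>j)\<close> vanishes and bounds the cost of \<open>Q\<^sub>i\<^sub>j\<close> trivially.
\<close>

section \<open>Attained minima and compact sets of functions\<close>

lemma minimum_eqI:
  assumes "is_minimum m A"
  shows "minimum A = m"
  using assms unfolding minimum_def is_minimum_def by (intro the_equality) (auto intro: antisym)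

text \<open>Tychonoff's theorem: the set is a full product of compact sets and functions carry the
  product topology. The index type may be infinite, so the boxes below pin irrelevant coordinates to
  \<open>{0}\<close>.\<close>

lemma compact_functions:
  fixes C :: "'a \<Rightarrow> 'b::topological_space set"
  assumes "\<And>i. compact (C i)"
  shows "compact {f. \<forall>i. f i \<in> C i}"
proof -
  have "{f. \<forall>i. f i \<in> C i} = PiE UNIV C" by (auto simp: PiE_iff)
  then show ?thesis
    using compactin_PiE[of "\<lambda>_. euclidean" UNIV C] assms by (simp add: euclidean_product_topology)
qed

lemma continuous_on_coordinate2 [continuous_intros]:
  "continuous_on UNIV (\<lambda>S :: 'a \<Rightarrow> 'b \<Rightarrow> 'c::topological_space. S i j)"
  by (rule continuous_on_product_then_coordinatewise[OF continuous_on_product_coordinates])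

section \<open>Linearity of the divergence and existence of flows\<close>

lemma incidence_transpose_sum:
  "incidence_transpose G (\<lambda>e. \<Sum>a\<in>A. c a * J a e) v = (\<Sum>a\<in>A. c a * incidence_transpose G (J a) v)"
  unfolding incidence_transpose_def sum_distrib_left
  by (subst sum.swap) (simp add: algebra_simps)

lemma incidence_transpose_scale:
  "incidence_transpose G (\<lambda>e. c * J e) v = c * incidence_transpose G J v"
  using incidence_transpose_sum[where A = "{()}" and c = "\<lambda>_. c" and J = "\<lambda>_. J"] by simp

lemma incidence_transpose_add:
  "incidence_transpose G (\<lambda>e. J e + K e) v = incidence_transpose G J v + incidence_transpose G K v"
  unfolding incidence_transpose_def by (simp add: algebra_simps sum.distrib)

lemma incidence_transpose_unit:
  assumes "finite (parcs G)" "a \<in> parcs G"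
  shows "incidence_transpose G (\<lambda>e. of_bool (e = a)) v = incidence G a v"
  using assms by (simp add: incidence_transpose_def of_bool_def if_distrib cong: if_cong)

context oriented_simple_graph
begin

text \<open>One unit is sent along an undirected walk from \<open>u\<close> to \<open>v\<close>; the
  contributions of the inner vertices telescope.\<close>

lemma path_flow_exists:
  assumes "u \<rightarrow>\<^sup>*\<^bsub>mk_symmetric (with_proj G)\<^esub> v"
  shows "\<exists>J. \<forall>w. incidence_transpose G J w = of_bool (w = v) - of_bool (w = u)"
proof -
  interpret S: pair_wf_digraph "mk_symmetric (with_proj G)" by (rule wellformed_mk_symmetric)
  show ?thesis
    using assms
  proof (induction rule: S.reachable_induct)
    case base
    have "incidence_transpose G (\<lambda>_. 0) w = 0" for w by (simp add: incidence_transpose_def)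
    then show ?case by auto
  next
    case (step p q)
    then obtain J where J: "incidence_transpose G J w = of_bool (w = p) - of_bool (w = u)" for w
      by blast
    \<comment> \<open>Absence of loops matters: on a loop the first branch of
      \<open>incidence\<close> would give -1 instead of 0.\<close>
    have ends: "incidence G (s, t) w = of_bool (w = t) - of_bool (w = s)" if "(s, t) \<in> parcs G" for s t w
      using that pair_no_loops[OF that] by (auto simp: incidence_def)
    have "(p, q) \<in> parcs G \<or> (q, p) \<in> parcs G"
      using step.hyps(2) by (auto simp: parcs_mk_symmetric)
    \<comment> \<open>The walk lives in the symmetrized graph, so an arc may be traversed against
      its orientation; then \<open>c\<close> is -1.\<close>
    then obtain c :: real and a where "a \<in> parcs G"
      and "c * incidence G a w = of_bool (w = q) - of_bool (w = p)" for w
    proof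
      assume "(p, q) \<in> parcs G"
      then show ?thesis using that[of "(p, q)" 1] ends by simp
    next
      assume "(q, p) \<in> parcs G"
      then show ?thesis using that[of "(q, p)" "-1"] ends by simp
    qed
    then have "incidence_transpose G (\<lambda>e. J e + c * of_bool (e = a)) w
        = of_bool (w = q) - of_bool (w = u)" for w
      using J incidence_transpose_unit[OF pair_finite_arcs]
      by (simp add: incidence_transpose_add incidence_transpose_scale)
    then show ?case by blast
  qed
qed

text \<open>From a root \<open>r\<close>, the amount \<open>b v\<close> is routed to every
  \<open>v\<close>. The total withdrawn at \<open>r\<close> is the sum of \<open>b\<close>, which is
  zero, so only \<open>b\<close> remains.\<close>

lemma flow_exists:
  assumes "Digraph_Component.connected (with_proj G)" "(\<Sum>v\<in>pverts G. b v) = 0"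
  shows "\<exists>J. \<forall>v\<in>pverts G. incidence_transpose G J v = b v"
proof -
  from assms(1) obtain r where r: "r \<in> pverts G"
    and "\<And>v. v \<in> pverts G \<Longrightarrow> r \<rightarrow>\<^sup>*\<^bsub>mk_symmetric (with_proj G)\<^esub> v"
    unfolding Digraph_Component.connected_def strongly_connected_def by auto
  then have "\<exists>J. \<forall>w. incidence_transpose G J w = of_bool (w = v) - of_bool (w = r)"
    if "v \<in> pverts G" for v
    using path_flow_exists that by blast
  then obtain J where J: "\<And>v w. v \<in> pverts G \<Longrightarrow>
      incidence_transpose G (J v) w = of_bool (w = v) - of_bool (w = r)"
    by metis
  have "incidence_transpose G (\<lambda>e. \<Sum>v\<in>pverts G. b v * J v e) w = b w" if "w \<in> pverts G" for w
  proof -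
    have "incidence_transpose G (\<lambda>e. \<Sum>v\<in>pverts G. b v * J v e) w
        = (\<Sum>v\<in>pverts G. b v * of_bool (w = v)) - (\<Sum>v\<in>pverts G. b v) * of_bool (w = r)"
      by (simp add: incidence_transpose_sum J algebra_simps sum_subtractf sum_distrib_left)
    also have "\<dots> = b w"
      using that assms(2) pair_finite_verts by (simp add: of_bool_def if_distrib cong: if_cong)
    finally show ?thesis .
  qed
  then show ?thesis by blast
qed

section \<open>Optimal flows and their rescaling\<close>

lemma minimal_flow_exists:
  assumes "\<forall>v\<in>pverts G. incidence_transpose G J0 v = b v"
  shows "\<exists>J. (\<forall>v\<in>pverts G. incidence_transpose G J v = b v) \<and>
    (\<forall>J'. (\<forall>v\<in>pverts G. incidence_transpose G J' v = b v) \<longrightarrow>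
       (\<Sum>e\<in>parcs G. \<bar>J e\<bar>) \<le> (\<Sum>e\<in>parcs G. \<bar>J' e\<bar>))"
proof -
  define cost where "cost J = (\<Sum>e\<in>parcs G. \<bar>J e\<bar>)" for J :: "'a \<times> 'a \<Rightarrow> real"
  \<comment> \<open>Values off the arcs affect neither cost nor feasibility; setting them to 0
    allows the search to be confined to a compact box.\<close>
  define trunc where "trunc J e = (if e \<in> parcs G then J e else 0)" for J :: "'a \<times> 'a \<Rightarrow> real" and e
  \<comment> \<open>The feasible set may be unbounded. A flow of cost at most \<open>M\<close> has
    all its arc values in \<open>{- M..M}\<close>, and a more expensive one loses to
    \<open>J0\<close>.\<close>
  define M where "M = cost J0"
  define box where
    "box = {J. \<forall>e. J e \<in> (if e \<in> parcs G then {- M..M} else {0})}"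
  define feasible where
    "feasible = {J. \<forall>v\<in>pverts G. incidence_transpose G J v = b v}"
  have trunc: "cost (trunc J) = cost J" "trunc J \<in> feasible \<longleftrightarrow> J \<in> feasible" for J
    by (simp_all add: cost_def trunc_def feasible_def incidence_transpose_def)
  have in_box: "trunc J \<in> box" if "cost J \<le> M" for J
  proof -
    have "\<bar>J e\<bar> \<le> M" if "e \<in> parcs G" for e
      using member_le_sum[OF that, of "\<lambda>e. \<bar>J e\<bar>"] pair_finite_arcs \<open>cost J \<le> M\<close>
      by (simp add: cost_def)
    then show ?thesis by (force simp: box_def trunc_def)
  qed
  have "compact box" unfolding box_def by (intro compact_functions) simp
  moreover have "closed feasible"
    unfolding feasible_def incidence_transpose_def Ball_def
    by (intro closed_Collect_all closed_Collect_imp closed_Collect_eq continuous_intros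
        continuous_on_product_coordinates) simp
  ultimately have "compact (box \<inter> feasible)" by blast
  moreover have "trunc J0 \<in> box \<inter> feasible"
    using in_box[of J0] trunc(2)[of J0] assms by (simp add: M_def feasible_def)
  moreover have "continuous_on (box \<inter> feasible) cost"
    unfolding cost_def
    by (rule continuous_on_subset[OF _ subset_UNIV])
       (intro continuous_intros continuous_on_product_coordinates)
  ultimately obtain J where J: "J \<in> box \<inter> feasible"
    and min: "\<And>J'. J' \<in> box \<inter> feasible \<Longrightarrow> cost J \<le> cost J'"
    using continuous_attains_inf[of "box \<inter> feasible" cost] by auto
  have "cost J \<le> cost J'" if "J' \<in> feasible" for J'
  proof (cases "cost J' \<le> M")
    case True
    then show ?thesis using min[of "trunc J'"] in_box[of J'] trunc[of J'] that by simp
  next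
    case False
    then show ?thesis using min[of "trunc J0"] \<open>trunc J0 \<in> box \<inter> feasible\<close> trunc(1)[of J0]
      by (simp add: M_def)
  qed
  then show ?thesis using J unfolding feasible_def cost_def by blast
qed

text \<open>\<open>W1\<close> is a definite description, so its minimality has to be earned from an
  attained minimum. A feasible flow exists because \<open>x\<close> and \<open>y\<close> have equal
  total mass and the graph is connected.\<close>

lemma is_minimum_W1:
  assumes "Digraph_Component.connected (with_proj G)" "x \<in> Prob (pverts G)" "y \<in> Prob (pverts G)"
  shows "is_minimum (W1 G x y) {\<Sum>e\<in>parcs G. \<bar>J e\<bar> | J.
    \<forall>v\<in>pverts G. incidence_transpose G J v = y v - x v}"
proof -
  have "(\<Sum>v\<in>pverts G. y v - x v) = 0" using assms(2,3) by (simp add: Prob_def sum_subtractf)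
  then obtain J0 where "\<forall>v\<in>pverts G. incidence_transpose G J0 v = y v - x v"
    using flow_exists[OF assms(1), of "\<lambda>v. y v - x v"] by blast
  from minimal_flow_exists[OF this]
  obtain J where J: "\<forall>v\<in>pverts G. incidence_transpose G J v = y v - x v"
    "\<And>J'. \<forall>v\<in>pverts G. incidence_transpose G J' v = y v - x v \<Longrightarrow>
      (\<Sum>e\<in>parcs G. \<bar>J e\<bar>) \<le> (\<Sum>e\<in>parcs G. \<bar>J' e\<bar>)"
    by blast
  then have "is_minimum (\<Sum>e\<in>parcs G. \<bar>J e\<bar>) {\<Sum>e\<in>parcs G. \<bar>J e\<bar> | J.
      \<forall>v\<in>pverts G. incidence_transpose G J v = y v - x v}"
    unfolding is_minimum_def by blast
  then show ?thesis unfolding W1_def by (simp only: minimum_eqI)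
qed

lemma scaled_W1_le:
  assumes "Digraph_Component.connected (with_proj G)" "x \<in> Prob (pverts G)" "y \<in> Prob (pverts G)"
    and "0 \<le> s" "\<forall>v\<in>pverts G. incidence_transpose G Q v - (x v - y v) * s = 0"
  shows "s * W1 G x y \<le> (\<Sum>e\<in>parcs G. \<bar>Q e\<bar>)"
proof (cases "s = 0")
  case True
  then show ?thesis by (simp add: sum_nonneg)
next
  case False
  with \<open>0 \<le> s\<close> have s: "0 < s" by simp
  \<comment> \<open>The sign turns the right-hand side \<open>x - y\<close> of the constraint on
    \<open>Q\<close> into the \<open>y - x\<close> required of a flow from \<open>x\<close> to
    \<open>y\<close>.\<close>
  define J where "J e = - (1 / s) * Q e" for e
  have "\<forall>v\<in>pverts G. incidence_transpose G J v = y v - x v"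
    using assms(5) s unfolding J_def incidence_transpose_scale by (simp add: field_simps)
  then have "W1 G x y \<le> (\<Sum>e\<in>parcs G. \<bar>J e\<bar>)"
    using is_minimum_W1[OF assms(1-3)] unfolding is_minimum_def by blast
  also have "\<dots> = (\<Sum>e\<in>parcs G. \<bar>Q e\<bar>) / s"
    using s by (simp add: J_def abs_mult sum_divide_distrib)
  finally show ?thesis using s by (simp add: field_simps)
qed

end

section \<open>Optimal doubly stochastic matrices\<close>

lemma DS_nonempty: "DS k \<noteq> {}"
proof -
  have "(\<lambda>i j. of_bool (i = j)) \<in> DS k"
    by (auto simp: DS_def of_bool_def)
  then show ?thesis by blast
qed

lemma DS_le_one:
  assumes "S \<in> DS k" "i < k" "j < k"
  shows "S i j \<le> 1"
proof -
  have "S i j \<le> (\<Sum>j<k. S i j)"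
    using assms by (intro member_le_sum) (auto simp: DS_def)
  then show ?thesis using assms by (simp add: DS_def)
qed

text \<open>A continuous cost attains its minimum on a nonempty compact set. Entries outside the
  \<open>k\<close> by \<open>k\<close> block are unconstrained in \<open>DS k\<close>, hence
  truncated to 0; the others lie in \<open>{0..1}\<close> by \<open>DS_le_one\<close>.\<close>

lemma is_minimum_lifted_cost:
  "is_minimum (lifted_cost d xs ys)
    {\<Sum>i<length xs. \<Sum>j<length xs. S i j * d (xs ! i) (ys ! j) | S. S \<in> DS (length xs)}"
proof -
  define k where "k = length xs"
  define cost where "cost S = (\<Sum>i<k. \<Sum>j<k. S i j * d (xs ! i) (ys ! j))" for S
  define trunc :: "(nat \<Rightarrow> nat \<Rightarrow> real) \<Rightarrow> nat \<Rightarrow> nat \<Rightarrow> real" where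
    "trunc S i j = (if i < k \<and> j < k then S i j else 0)" for S i j
  \<comment> \<open>The nested form lets \<open>compact_functions\<close> apply twice, once for each
    index.\<close>
  define box :: "(nat \<Rightarrow> nat \<Rightarrow> real) set" where
    "box = {S. \<forall>i. S i \<in> {f. \<forall>j. f j \<in> (if i < k \<and> j < k then {0..1} else {0})}}"
  have trunc: "cost (trunc S) = cost S" "trunc S \<in> DS k \<longleftrightarrow> S \<in> DS k" for S
    by (simp_all add: cost_def trunc_def DS_def)
  have in_box: "trunc S \<in> box" if "S \<in> DS k" for S
    using that DS_le_one[OF that] by (auto simp: box_def trunc_def DS_def)
  have "compact box"
    unfolding box_def by (intro compact_functions) simp
  moreover have "closed (DS k)"
    unfolding DS_def
    by (intro closed_Collect_conj closed_Collect_all closed_Collect_imp closed_Collect_eq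
        closed_Collect_le continuous_intros) simp_all
  ultimately have "compact (box \<inter> DS k)" by blast
  moreover have "box \<inter> DS k \<noteq> {}"
    using DS_nonempty[of k] in_box trunc(2) by blast
  moreover have "continuous_on (box \<inter> DS k) cost"
    unfolding cost_def
    by (rule continuous_on_subset[OF _ subset_UNIV]) (intro continuous_intros)
  ultimately obtain S where S: "S \<in> DS k"
    and min: "\<And>T. T \<in> box \<inter> DS k \<Longrightarrow> cost S \<le> cost T"
    using continuous_attains_inf[of "box \<inter> DS k" cost] by auto
  have "cost S \<le> cost T" if "T \<in> DS k" for T
    using min[of "trunc T"] in_box[OF that] trunc[of T] that by simp
  then have "is_minimum (cost S) {cost S | S. S \<in> DS k}"
    using S unfolding is_minimum_def by blast
  then show ?thesis
    unfolding lifted_cost_def cost_def k_def by (simp only: minimum_eqI)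
qed

section \<open>Comparison of the lifted distance with the joint minimization over \<open>Q\<close>
  and \<open>S\<close>\<close>

theorem proposition5p8:
  fixes G :: "'v pair_pre_digraph" and k :: nat
    and X Y :: "('v \<Rightarrow> real) multiset" and x y :: "('v \<Rightarrow> real) list"
  assumes "oriented_simple_graph G"
    and "Digraph_Component.connected (with_proj G)"
    and "X \<in> unordered_tuples k (Prob (pverts G))" and "X = mset x"
    and "Y \<in> unordered_tuples k (Prob (pverts G))" and "Y = mset y"
  shows "is_minimum (lifted_dist (W1 G) X Y)
    {\<Sum>i<k. \<Sum>j<k. \<Sum>e\<in>parcs G. \<bar>Q i j e\<bar> |
       (Q :: nat \<Rightarrow> nat \<Rightarrow> 'v \<times> 'v \<Rightarrow> real) S.
       S \<in> DS k \<and>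
       (\<forall>i<k. \<forall>j<k. \<forall>v\<in>pverts G.
          incidence_transpose G (Q i j) v - ((x ! i) v - (y ! j) v) * S i j = 0)}"
proof -
  interpret oriented_simple_graph G by fact
  note W1_min = is_minimum_W1[OF assms(2)]
  have len: "length x = k" "length y = k"
    using assms(3-6) by (auto simp: unordered_tuples_def)
  have prob: "x ! i \<in> Prob (pverts G)" "y ! i \<in> Prob (pverts G)" if "i < k" for i
    using assms(3-6) that len by (auto simp: unordered_tuples_def)
  \<comment> \<open>By \<open>lifted_dist_mset\<close> the tuples picked by \<open>SOME\<close> may
    be replaced by the given \<open>x\<close> and \<open>y\<close>.\<close>
  have A: "is_minimum (lifted_dist (W1 G) X Y)
      {\<Sum>i<k. \<Sum>j<k. S i j * W1 G (x ! i) (y ! j) | S. S \<in> DS k}"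
    using is_minimum_lifted_cost[of "W1 G" x y] lifted_dist_mset[of x y "W1 G"] assms(4,6) len by simp
  then obtain S where S: "S \<in> DS k"
    and A_eq: "lifted_dist (W1 G) X Y = (\<Sum>i<k. \<Sum>j<k. S i j * W1 G (x ! i) (y ! j))"
    unfolding is_minimum_def by blast
  have "\<exists>J. (\<forall>v\<in>pverts G. incidence_transpose G J v = (y ! j) v - (x ! i) v) \<and>
      W1 G (x ! i) (y ! j) = (\<Sum>e\<in>parcs G. \<bar>J e\<bar>)" if "i < k" "j < k" for i j
    using W1_min[OF prob(1)[OF that(1)] prob(2)[OF that(2)]] unfolding is_minimum_def by blast
  then obtain J where J:
    "\<And>i j v. i < k \<Longrightarrow> j < k \<Longrightarrow> v \<in> pverts G \<Longrightarrow>
      incidence_transpose G (J i j) v = (y ! j) v - (x ! i) v"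
    "\<And>i j. i < k \<Longrightarrow> j < k \<Longrightarrow> W1 G (x ! i) (y ! j) = (\<Sum>e\<in>parcs G. \<bar>J i j e\<bar>)"
    by metis
  \<comment> \<open>Optimal flows weighted by the optimal \<open>S\<close>: since
    \<open>S i j\<close> is nonnegative, the cost of \<open>Q i j\<close> is exactly
    \<open>S i j\<close> times the Wasserstein distance, so the value is attained.\<close>
  define Q where "Q i j e = - S i j * J i j e" for i j e
  have nonneg: "0 \<le> T i j" if "T \<in> DS k" "i < k" "j < k" for T i j
    using that by (simp add: DS_def)
  have "(\<Sum>e\<in>parcs G. \<bar>Q i j e\<bar>) = S i j * W1 G (x ! i) (y ! j)" if "i < k" "j < k" for i j
    using J(2)[OF that] nonneg[OF S that] by (simp add: Q_def abs_mult sum_distrib_left)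
  then have Q_cost: "lifted_dist (W1 G) X Y = (\<Sum>i<k. \<Sum>j<k. \<Sum>e\<in>parcs G. \<bar>Q i j e\<bar>)"
    unfolding A_eq by simp
  have Q_feasible: "\<forall>i<k. \<forall>j<k. \<forall>v\<in>pverts G.
      incidence_transpose G (Q i j) v - ((x ! i) v - (y ! j) v) * S i j = 0"
    unfolding Q_def incidence_transpose_scale by (simp add: J(1) algebra_simps)
  \<comment> \<open>For an arbitrary feasible pair, minimality over \<open>DS k\<close> first bounds
    the distance by the cost of \<open>T\<close>; \<open>scaled_W1_le\<close> then bounds each term
    by the cost of \<open>R i j\<close>.\<close>
  have lower: "lifted_dist (W1 G) X Y \<le> (\<Sum>i<k. \<Sum>j<k. \<Sum>e\<in>parcs G. \<bar>R i j e\<bar>)"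
    if T: "T \<in> DS k" and R: "\<forall>i<k. \<forall>j<k. \<forall>v\<in>pverts G.
      incidence_transpose G (R i j) v - ((x ! i) v - (y ! j) v) * T i j = 0" for R T
  proof -
    have "lifted_dist (W1 G) X Y \<le> (\<Sum>i<k. \<Sum>j<k. T i j * W1 G (x ! i) (y ! j))"
      using A T unfolding is_minimum_def by blast
    also have "\<dots> \<le> (\<Sum>i<k. \<Sum>j<k. \<Sum>e\<in>parcs G. \<bar>R i j e\<bar>)"
      using R by (intro sum_mono scaled_W1_le[OF assms(2)]) (auto simp: prob nonneg[OF T])
    finally show ?thesis .
  qed
  show ?thesis
    unfolding is_minimum_def using S Q_cost Q_feasible lower by blast
qed

end
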